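(* Consider $\mathrm{SRD}^\rho$ with $\rho>\sqrt2$, let $\alpha=\arcsin(1/\rho)$, and consider the algorithms $1$-$\mathrm{RB}_{\beta,\gamma}$ with $(\beta,\gamma)\in[0,\pi/2-\alpha]^2$; call optimal a choice of $(\beta,\gamma)$ minimizing the expected rendezvous time. If $\rho<\csc\left(\tfrac12\arccos\tfrac23\right)\approx 2.44949$, then the optimal $1$-$\mathrm{RB}_{\beta,\gamma}$ algorithm is obtained for $\overline\gamma=0$, and the algorithm is identical to the optimal $\mathrm{1RB}_\beta$ algorithm (i.e. the one with $\beta=\max(0,\arccos(3/4)-\alpha)$). If $\rho\ge\csc\left(\tfrac12\arccos\tfrac23\right)$, then the optimal $1$-$\mathrm{RB}_{\beta,\gamma}$ is obtained for $$\overline\gamma=\arccos\left(\tfrac23\right)-2\arcsin\left(\tfrac1\rho\right),\qquad \overline\beta=\arccos\left(\tfrac34\cos\left(\arccos\left(\tfrac23\right)-2\arcsin\left(\tfrac1\rho\right)\right)\right)-\arcsin\left(\tfrac1\rho\right),$$ and for these parameters the algorithm has competitive ratio $\rho\cos\overline\beta$, which equals $$\frac12\left(-\frac{\sqrt5}{\rho^2}+\sqrt{\rho^2-1}-\frac{2\sqrt{\rho^2-1}}{\rho^2}+2\sqrt{1-\frac{\left(\rho\left(\sqrt{5-\frac5{\rho^2}}+\rho\right)-2\right)^2}{4\rho^4}}+\sqrt5\right),$$ and it is $\delta$-effective with $\delta\approx5.32366$.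
   Context: Symmetric Rendezvous in a Disk. Two robots start on a circle centred at a known reference point $O$; both know $O$, the radius and their initial distance, but not which of the two possible positions on the circle at that distance is the peer's. Robots move with speed at most $1$, run the same synchronized randomized algorithm with independent random bits, and meet only when at the same point at the same time. In $\mathrm{SRD}^\rho$ ($\rho>\sqrt2$) the circle has radius $\rho$ and initial distance $2$; in $\mathrm{SRD}_\alpha$ ($0<\alpha<\pi/4$) the circle is the unit circle and the robots are at angular distance $2\alpha$; they are equivalent under scaling, with $\rho=1/\sin\alpha$. The competitive ratio is the expected rendezvous time divided by the offline optimum ($1$ in $\mathrm{SRD}^\rho$, $\sin\alpha$ in $\mathrm{SRD}_\alpha$). A family indexed by $\rho$ is $\delta$-effective if $\delta$ is the largest $\rho$ for which its expected rendezvous time in $\mathrm{SRD}^\rho$ is at most $4.25$. Moves (in $\mathrm{SRD}_\alpha$): for a robot at $A$ with $|OA|=r>0$, a direction (clockwise/counterclockwise), an angle $\phi\in\{\alpha,2\alpha\}$ and $\theta\in[0,\pi/2)$, let $L$ be the ray from $O$ obtained by rotating ray $OA$ by $\phi$ in that direction; the robot walks straight from $A$ to the point $P\in L$ with $\angle OAP=\theta$ ($P=O$ if $\theta=0$). A $\beta$-darting is this move with $\phi=\alpha,\theta=\beta$; a random $\beta$-darting uses an independent fair coin for the direction. A $\gamma$-darting in the opposite direction is the move with $\phi=2\alpha,\theta=\gamma$ in the direction opposite to the one just used. Algorithm $k$-$\mathrm{RB}_{\beta,\gamma}$ ($k\in\{1,2,\dots\}\cup\{\infty\}$): repeat $k$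 times: do a random $\beta$-darting, then a $\gamma$-darting in the opposite direction; afterwards (if $k$ finite and the peer is not yet met) walk straight to $O$. Algorithm $\mathrm{1RB}_\beta$: a random $\beta$-darting followed by walking straight to $O$; thus $1$-$\mathrm{RB}_{\beta,0}$ coincides with $\mathrm{1RB}_\beta$. Robots stop upon meeting. *)

theory Defs
  imports "HOL-Analysis.Analysis" "HOL-Probability.Probability"
begin

text \<open>The reference point \<open>O\<close> is the origin of the complex plane.\<close>

definition angle_at :: "complex \<Rightarrow> complex \<Rightarrow> complex \<Rightarrow> real" where
  "angle_at X Y Z = arccos (((X - Y) \<bullet> (Z - Y)) / (norm (X - Y) * norm (Z - Y)))"

definition rotated_ray :: "bool \<Rightarrow> real \<Rightarrow> complex \<Rightarrow> complex set" where
  "rotated_ray ccw \<phi> A = {of_real s * cis (if ccw then \<phi> else - \<phi>) * A | s. 0 \<le> s}"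

text \<open>
  End point of a move from \<open>A\<close>. For \<open>A \<noteq> 0\<close>, \<open>0 < \<phi> < pi / 2\<close> and \<open>0 \<le> \<theta> < pi / 2\<close> the point
  is unique; for \<open>\<theta> = 0\<close> it is \<open>0\<close>. A robot that has reached \<open>0\<close>, where the move is
  undefined, stays there. This never matters for the rendezvous time: every algorithm below
  brings both robots to \<open>0\<close> after a darting with angle \<open>0\<close> at the same time, or at its end.
\<close>

definition dart :: "bool \<Rightarrow> real \<Rightarrow> real \<Rightarrow> complex \<Rightarrow> complex" where
  "dart ccw \<phi> \<theta> A =
     (if A = 0 then 0 else (THE P. P \<in> rotated_ray ccw \<phi> A \<and> angle_at 0 A P = \<theta>))"

text \<open>
  Position at time \<open>t\<close> of a robot that visits the given points at unit speed along straight
  segments and then stays at the last one.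
\<close>

fun walk :: "complex \<Rightarrow> complex list \<Rightarrow> real \<Rightarrow> complex" where
  "walk A [] t = A"
| "walk A (P # Ps) t =
     (if t < dist A P then A + of_real (t / dist A P) * (P - A)
      else walk P Ps (t - dist A P))"

text \<open>A randomized algorithm maps a starting point to a distribution of trajectories.\<close>

type_synonym algorithm = "complex \<Rightarrow> (real \<Rightarrow> complex) pmf"

fun RB_route :: "real \<Rightarrow> real \<Rightarrow> real \<Rightarrow> complex \<Rightarrow> bool list \<Rightarrow> complex list" where
  "RB_route \<alpha> \<beta> \<gamma> A [] = [0]"
| "RB_route \<alpha> \<beta> \<gamma> A (b # bs) =
     (let P = dart b \<alpha> \<beta> A; Q = dart (\<not> b) (2 * \<alpha>) \<gamma> P
      in P # Q # RB_route \<alpha> \<beta> \<gamma> Q bs)"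

definition RB :: "nat \<Rightarrow> real \<Rightarrow> real \<Rightarrow> real \<Rightarrow> algorithm" where
  "RB k \<alpha> \<beta> \<gamma> A =
     map_pmf (\<lambda>bs. walk A (RB_route \<alpha> \<beta> \<gamma> A bs)) (replicate_pmf k (bernoulli_pmf (1/2)))"

definition oneRB :: "real \<Rightarrow> real \<Rightarrow> algorithm" where
  "oneRB \<alpha> \<beta> A = map_pmf (\<lambda>b. walk A [dart b \<alpha> \<beta> A, 0]) (bernoulli_pmf (1/2))"

text \<open>
  Robots stop upon meeting, so only the first coincidence of the unstopped trajectories counts.
  The algorithms above end with both robots at \<open>0\<close>, so the set is never empty.
\<close>

definition rendezvous_time :: "(real \<Rightarrow> complex) \<Rightarrow> (real \<Rightarrow> complex) \<Rightarrow> real" where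
  "rendezvous_time f g = Inf {t. 0 \<le> t \<and> f t = g t}"

definition expected_time :: "algorithm \<Rightarrow> complex \<Rightarrow> complex \<Rightarrow> real" where
  "expected_time alg A B =
     measure_pmf.expectation (pair_pmf (alg A) (alg B)) (\<lambda>(f, g). rendezvous_time f g)"

definition SRD :: "real \<Rightarrow> complex \<Rightarrow> complex \<Rightarrow> bool" where
  "SRD \<rho> A B \<longleftrightarrow> norm A = \<rho> \<and> norm B = \<rho> \<and> dist A B = 2"

text \<open>The offline optimum is half of the initial distance, i.e. 1 for the instances in \<open>SRD\<close>.\<close>

definition competitive_ratio :: "algorithm \<Rightarrow> complex \<Rightarrow> complex \<Rightarrow> real" where
  "competitive_ratio alg A B = expected_time alg A B / (dist A B / 2)"

text \<open>The set \<open>I\<close> contains the radii for which the family is defined.\<close>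

definition effective :: "real set \<Rightarrow> (real \<Rightarrow> algorithm) \<Rightarrow> real \<Rightarrow> bool" where
  "effective I F \<delta> \<longleftrightarrow>
     (let S = {\<rho> \<in> I. \<forall>A B. SRD \<rho> A B \<longrightarrow> expected_time (F \<rho>) A B \<le> 4.25}
      in \<delta> \<in> S \<and> (\<forall>\<rho>\<in>S. \<rho> \<le> \<delta>))"

definition optimal_RB1 :: "real \<Rightarrow> complex \<Rightarrow> complex \<Rightarrow> real \<times> real \<Rightarrow> bool" where
  "optimal_RB1 \<rho> A B =
     is_arg_min (\<lambda>(\<beta>, \<gamma>). expected_time (RB 1 (arcsin (1/\<rho>)) \<beta> \<gamma>) A B)
       (\<lambda>p. p \<in> {0..pi/2 - arcsin (1/\<rho>)} \<times> {0..pi/2 - arcsin (1/\<rho>)})"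

definition optimal_oneRB :: "real \<Rightarrow> complex \<Rightarrow> complex \<Rightarrow> real \<Rightarrow> bool" where
  "optimal_oneRB \<rho> A B =
     is_arg_min (\<lambda>\<beta>. expected_time (oneRB (arcsin (1/\<rho>)) \<beta>) A B) (\<lambda>\<beta>. \<beta> \<in> {0..<pi/2})"

definition rho_threshold :: real where
  "rho_threshold = 1 / sin (1/2 * arccos (2/3))"

definition gamma_opt :: "real \<Rightarrow> real" where
  "gamma_opt \<rho> = arccos (2/3) - 2 * arcsin (1/\<rho>)"

definition beta_opt :: "real \<Rightarrow> real" where
  "beta_opt \<rho> = arccos (3/4 * cos (arccos (2/3) - 2 * arcsin (1/\<rho>))) - arcsin (1/\<rho>)"

end

theory Submission
  imports Defs
begin

text \<open>
  If the peer is mirrored (opposite coins), the robots meet on the bisector of their starting points,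
  at the end of the first or of the second dart; if it is rotated (equal coins), only at the centre.
  Averaging gives the expected time
  \<open>\<rho> * (sin \<alpha> + g * sin \<beta>) / sin (\<alpha> + \<beta>)\<close> with
  \<open>g = 3/4 * (sin (2 * \<alpha>) + 2/3 * sin \<gamma>) / sin (2 * \<alpha> + \<gamma>)\<close>.
  Both have the shape \<open>(sin \<phi> + g * sin y) / sin (\<phi> + y)\<close>, whose minimum over \<open>y \<ge> 0\<close> is
  \<open>cos y0\<close> at \<open>y0 = max 0 (arccos g - \<phi>)\<close>, so \<open>\<gamma>\<close> and then \<open>\<beta>\<close> are optimised in turn.
\<close>

section \<open>Trigonometry of a single darting move\<close>

text \<open>Law of sines in the triangle with the centre, a robot at distance 1 from it and the
  target \<open>P\<close>: the angles are \<open>\<phi>\<close> at the centre,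
  \<open>\<theta>\<close> at the robot and \<open>pi - \<phi> - \<theta>\<close> at
  \<open>P\<close>. Hence \<open>s\<close> is the distance of \<open>P\<close> from the centre and
  \<open>sin \<phi> / sin (\<phi> + \<theta>)\<close> the length walked. The first identity projects
  the walk onto the line to the centre.\<close>

lemma one_minus_dart:
  fixes \<phi> \<theta> :: real
  assumes "0 < \<phi>" "0 \<le> \<theta>" "\<phi> + \<theta> < pi"
  defines "s \<equiv> sin \<theta> / sin (\<phi> + \<theta>)"
  shows "1 - s * cos \<phi> = sin \<phi> / sin (\<phi> + \<theta>) * cos \<theta>"
    and "norm (1 - of_real s * cis (if ccw then \<phi> else - \<phi>)) = sin \<phi> / sin (\<phi> + \<theta>)"
proof -
  have pos: "0 < sin \<phi>" "0 < sin (\<phi> + \<theta>)"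
    using assms by (auto intro!: sin_gt_zero)
  show re: "1 - s * cos \<phi> = sin \<phi> / sin (\<phi> + \<theta>) * cos \<theta>"
    using pos(2) unfolding s_def by (simp add: field_simps) (simp add: sin_add)
  \<comment> \<open>Instantiated with \<open>sin \<phi>\<close>, \<open>cos \<theta>\<close>,
    \<open>sin \<theta>\<close>, \<open>sin (\<phi> + \<theta>)\<close> for \<open>a\<close>,
    \<open>b\<close>, \<open>c\<close>, \<open>d\<close>.\<close>
  have "(a / d * b)\<^sup>2 + (c / d * a)\<^sup>2 = (a / d)\<^sup>2 * (b\<^sup>2 + c\<^sup>2)" for a b c d :: real
    by (simp add: power_mult_distrib power_divide algebra_simps add_divide_distrib)
  then have "(1 - s * cos \<phi>)\<^sup>2 + (s * sin \<phi>)\<^sup>2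
      = (sin \<phi> / sin (\<phi> + \<theta>))\<^sup>2 * ((cos \<theta>)\<^sup>2 + (sin \<theta>)\<^sup>2)"
    unfolding re unfolding s_def .
  then have "sqrt ((1 - s * cos \<phi>)\<^sup>2 + (s * sin \<phi>)\<^sup>2) = sin \<phi> / sin (\<phi> + \<theta>)"
    using pos by (simp add: real_sqrt_unique)
  then show "norm (1 - of_real s * cis (if ccw then \<phi> else - \<phi>)) = sin \<phi> / sin (\<phi> + \<theta>)"
    by (simp add: cmod_def)
qed

text \<open>Evaluates the definite description. The law of sines supplies the candidate
  \<open>s0\<close>. For uniqueness, the angle at \<open>A\<close> determines both
  \<open>cos \<theta>\<close> and \<open>sin \<theta>\<close> in terms of \<open>s\<close>, and
  inserting these into the addition formula for \<open>sin (\<phi> + \<theta>)\<close> forces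
  \<open>s = s0\<close>.\<close>

lemma dart_eq:
  assumes A: "A \<noteq> 0" and \<phi>: "0 < \<phi>" and \<theta>: "0 \<le> \<theta>" and sum: "\<phi> + \<theta> < pi"
  shows "dart ccw \<phi> \<theta> A
    = of_real (sin \<theta> / sin (\<phi> + \<theta>)) * cis (if ccw then \<phi> else - \<phi>) * A"
proof -
  define u where "u = cis (if ccw then \<phi> else - \<phi>)"
  define s0 where "s0 = sin \<theta> / sin (\<phi> + \<theta>)"
  define D where "D s = norm (1 - of_real s * u)" for s
  have u: "Re u = cos \<phi>" "(Im u)\<^sup>2 = (sin \<phi>)\<^sup>2"
    by (auto simp: u_def)
  have sin_pos: "0 < sin \<phi>" "0 < sin (\<phi> + \<theta>)" "0 \<le> sin \<theta>"
    using \<phi> \<theta> sum by (auto intro!: sin_gt_zero sin_ge_zero)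
  have D2: "(D s)\<^sup>2 = (1 - s * cos \<phi>)\<^sup>2 + (s * sin \<phi>)\<^sup>2" for s
    unfolding D_def cmod_power2 by (simp add: u power_mult_distrib)
  have D_pos: "0 < D s" for s
  proof -
    have "(D s)\<^sup>2 \<noteq> 0"
      using sin_pos(1) unfolding D2 by (auto simp: sum_power2_eq_zero_iff)
    then show ?thesis by (simp add: D_def)
  qed
  \<comment> \<open>The factor \<open>A\<close> cancels because angles are invariant under rotation
    and scaling, so the angle is a function of \<open>s\<close> alone.\<close>
  have angle: "angle_at 0 A (of_real s * u * A) = arccos ((1 - s * cos \<phi>) / D s)" for s
  proof -
    have "norm (of_real s * u * A - A) = norm ((1 - of_real s * u) * A)"
      by (simp add: algebra_simps norm_minus_commute)
    then have n: "norm (of_real s * u * A - A) = D s * norm A"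
      by (simp add: norm_mult D_def)
    have "(0 - A) \<bullet> (of_real s * u * A - A) = (1 - s * cos \<phi>) * (norm A)\<^sup>2"
      unfolding cmod_power2 inner_complex_def using u(1)
      by (simp add: algebra_simps power2_eq_square)
    then show ?thesis
      unfolding angle_at_def n using A by (simp add: power2_eq_square)
  qed
  have "D s0 = sin \<phi> / sin (\<phi> + \<theta>)"
    unfolding D_def s0_def u_def using one_minus_dart(2) \<phi> \<theta> sum .
  then have angle0: "angle_at 0 A (of_real s0 * u * A) = \<theta>"
    unfolding angle s0_def one_minus_dart(1)[OF \<phi> \<theta> sum]
    using sin_pos \<phi> \<theta> sum by (simp add: arccos_cos s0_def)
  have uniq: "s = s0" if s: "0 \<le> s" and "angle_at 0 A (of_real s * u * A) = \<theta>" for s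
  proof -
    have th: "\<theta> = arccos ((1 - s * cos \<phi>) / D s)"
      using that angle by simp
    have "(1 - s * cos \<phi>)\<^sup>2 \<le> (D s)\<^sup>2"
      unfolding D2 by simp
    then have "\<bar>1 - s * cos \<phi>\<bar> \<le> D s"
      using D_pos[of s] by (simp add: abs_le_square_iff[symmetric])
    then have "\<bar>(1 - s * cos \<phi>) / D s\<bar> \<le> 1"
      using D_pos[of s] by simp
    then have c: "cos \<theta> = (1 - s * cos \<phi>) / D s"
      using th by (simp add: cos_arccos_abs)
    have "(sin \<theta>)\<^sup>2 = (D s)\<^sup>2 / (D s)\<^sup>2 - ((1 - s * cos \<phi>) / D s)\<^sup>2"
      using D_pos[of s] unfolding sin_squared_eq c by simp
    then have "(sin \<theta>)\<^sup>2 = (s * sin \<phi> / D s)\<^sup>2"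
      unfolding power_divide diff_divide_distrib[symmetric] D2 by simp
    then have sn: "sin \<theta> = s * sin \<phi> / D s"
      using sin_pos s D_pos[of s] by (simp add: power2_eq_iff_nonneg)
    \<comment> \<open>The terms with \<open>sin \<phi> * cos \<phi>\<close> cancel, which leaves
      \<open>sin (\<phi> + \<theta>) = sin \<phi> / D s\<close>.\<close>
    have "s * sin (\<phi> + \<theta>) = sin \<theta>"
      unfolding sin_add unfolding c sn using D_pos[of s] by (simp add: field_simps)
    then show ?thesis using sin_pos by (simp add: s0_def field_simps)
  qed
  have "(THE P. P \<in> rotated_ray ccw \<phi> A \<and> angle_at 0 A P = \<theta>) = of_real s0 * u * A"
  proof (rule the_equality)
    show "of_real s0 * u * A \<in> rotated_ray ccw \<phi> A \<and> angle_at 0 A (of_real s0 * u * A) = \<theta>"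
      using sin_pos angle0 unfolding rotated_ray_def u_def
      by (auto intro!: exI[of _ s0] simp: s0_def)
  next
    fix P assume "P \<in> rotated_ray ccw \<phi> A \<and> angle_at 0 A P = \<theta>"
    then show "P = of_real s0 * u * A"
      using uniq unfolding rotated_ray_def u_def by auto
  qed
  then show ?thesis
    using A by (simp add: dart_def s0_def u_def)
qed

lemma dist_dart:
  assumes "A \<noteq> 0" and "0 < \<phi>" and "0 \<le> \<theta>" and "\<phi> + \<theta> < pi"
  shows "dist A (dart ccw \<phi> \<theta> A) = sin \<phi> / sin (\<phi> + \<theta>) * norm A"
proof -
  have "dist A (dart ccw \<phi> \<theta> A)
      = norm ((1 - of_real (sin \<theta> / sin (\<phi> + \<theta>)) * cis (if ccw then \<phi> else - \<phi>)) * A)"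
    unfolding dart_eq[OF assms] dist_norm by (simp only: left_diff_distrib mult_1_left)
  then show ?thesis
    unfolding norm_mult one_minus_dart(2)[OF assms(2-4)] .
qed

section \<open>Walks under isometries, and first meeting times\<close>

lemma walk_0: "walk A Ps 0 = A"
  by (induction Ps arbitrary: A) auto

text \<open>A linear isometry keeps segment lengths, hence the timing. It is applied to the rotation
  taking one start to the other and to the reflection exchanging them.\<close>

lemma walk_map:
  assumes "orthogonal_transformation h"
  shows "walk (h A) (map h Ps) t = h (walk A Ps t)"
proof (induction Ps arbitrary: A t)
  case (Cons P Ps)
  have lin: "linear h"
    using assms by (rule orthogonal_transformation_linear)
  have d: "dist (h A) (h P) = dist A P"
    unfolding dist_norm linear_diff[OF lin, symmetric] orthogonal_transformation_norm[OF assms] ..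
  show ?case
    unfolding list.map walk.simps d Cons.IH scaleR_conv_of_real[symmetric]
    by (cases "t < dist A P")
      (simp_all only: linear_add[OF lin] linear_diff[OF lin] linear_scale[OF lin] if_True if_False)
qed simp

text \<open>
  The half-plane \<open>0 < w \<bullet> v\<close> will be chosen such that the robots cannot coincide while one of them
  is inside it.
\<close>

definition first_hit :: "complex \<Rightarrow> complex \<Rightarrow> (real \<Rightarrow> complex) \<Rightarrow> real \<Rightarrow> bool" where
  "first_hit v z f T \<longleftrightarrow> 0 \<le> T \<and> (\<forall>t. 0 \<le> t \<and> t < T \<longrightarrow> 0 < f t \<bullet> v) \<and> f T = z"

text \<open>Before the end of the segment the convex weight at \<open>A\<close> is still positive,
  so \<open>P\<close> itself may lie on the boundary line of the half-plane.\<close>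

lemma segment_inner_pos:
  assumes "0 < A \<bullet> v" and "0 \<le> P \<bullet> v" and "0 \<le> t" and "t < d"
  shows "0 < (A + of_real (t / d) * (P - A)) \<bullet> v"
proof -
  have "(A + of_real (t / d) * (P - A)) \<bullet> v = (1 - t / d) * (A \<bullet> v) + t / d * (P \<bullet> v)"
    unfolding scaleR_conv_of_real[symmetric] inner_add_left inner_scaleR_left inner_diff_left
    by (simp add: algebra_simps)
  moreover have "0 < (1 - t / d) * (A \<bullet> v)" "0 \<le> t / d * (P \<bullet> v)"
    using assms by auto
  ultimately show ?thesis by linarith
qed

lemma first_hit_next:
  assumes "0 < A \<bullet> v" and "0 \<le> P \<bullet> v"
  shows "first_hit v P (walk A (P # Ps)) (dist A P)"
  using assms by (auto simp: first_hit_def walk_0 intro!: segment_inner_pos simp del: of_real_divide)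

lemma first_hit_step:
  assumes "0 < A \<bullet> v" and "0 \<le> P \<bullet> v" and "first_hit v z (walk P Ps) T"
  shows "first_hit v z (walk A (P # Ps)) (dist A P + T)"
  using assms by (auto simp: first_hit_def intro!: segment_inner_pos simp del: of_real_divide)

text \<open>The infimum is attained at \<open>T\<close>: up to then \<open>f\<close> stays in the
  half-plane, where coincidence with \<open>g\<close> is excluded.\<close>

lemma rendezvous_time_eq:
  assumes "first_hit v z f T" and "\<And>t. 0 < f t \<bullet> v \<Longrightarrow> f t \<noteq> g t" and "g T = z"
  shows "rendezvous_time f g = T"
  unfolding rendezvous_time_def
  using assms by (intro cInf_eq_minimum) (auto simp: first_hit_def not_le[symmetric])

lemma rendezvous_time_commute: "rendezvous_time f g = rendezvous_time g f"
  unfolding rendezvous_time_def by (rule arg_cong[where f = Inf]) auto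

section \<open>The expectation as an average over coin pairs\<close>

lemma expected_time_commute: "expected_time alg A B = expected_time alg B A"
  unfolding expected_time_def
  by (subst pair_commute_pmf, subst integral_map_pmf)
    (simp add: case_prod_unfold rendezvous_time_commute)

lemma bernoulli_half: "bernoulli_pmf (1/2) = pmf_of_set UNIV"
  by (rule pmf_eqI) (simp add: pmf_bernoulli_half)

text \<open>The two fair coins are jointly uniform on four outcomes, so the expectation is a plain
  average of four meeting times.\<close>

lemma expected_time_RB1:
  defines "f \<equiv> \<lambda>\<alpha> \<beta> \<gamma> A b. walk A (RB_route \<alpha> \<beta> \<gamma> A [b])"
  shows "expected_time (RB 1 \<alpha> \<beta> \<gamma>) A B =
    (\<Sum>b\<in>UNIV. \<Sum>c\<in>UNIV. rendezvous_time (f \<alpha> \<beta> \<gamma> A b) (f \<alpha> \<beta> \<gamma> B c)) / 4"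
proof -
  have RB: "RB 1 \<alpha> \<beta> \<gamma> A = map_pmf (f \<alpha> \<beta> \<gamma> A) (pmf_of_set UNIV)" for A
    unfolding RB_def replicate_pmf_1 bernoulli_half f_def by (simp add: map_pmf_comp)
  have "pair_pmf (pmf_of_set (UNIV :: bool set)) (pmf_of_set (UNIV :: bool set)) = pmf_of_set UNIV"
    by (rule pmf_eqI) (auto simp: pmf_pair)
  then have "pair_pmf (RB 1 \<alpha> \<beta> \<gamma> A) (RB 1 \<alpha> \<beta> \<gamma> B)
      = map_pmf (\<lambda>(b, c). (f \<alpha> \<beta> \<gamma> A b, f \<alpha> \<beta> \<gamma> B c)) (pmf_of_set UNIV)"
    unfolding RB by (simp flip: map_pair)
  then show ?thesis
    unfolding expected_time_def
    by (simp add: integral_pmf_of_set case_prod_unfold sum.cartesian_product flip: UNIV_Times_UNIV)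
qed

text \<open>In either case the second dart ends at the centre, either because it starts there or
  because its angle is 0. What remains is a final segment of length 0, which does not change the
  walk.\<close>

lemma RB1_eq_oneRB:
  assumes "0 < \<alpha>" "\<alpha> < pi / 2" "0 \<le> \<beta>" "\<alpha> + \<beta> < pi" "\<beta> = 0 \<or> \<gamma> = 0"
  shows "RB 1 \<alpha> \<beta> \<gamma> = oneRB \<alpha> \<beta>"
proof (rule ext)
  fix A
  have w: "walk A [P, 0, 0] = walk A [P, 0]" for A P
    by (rule ext) (auto simp: algebra_simps)
  have "dart c (2 * \<alpha>) \<gamma> (dart b \<alpha> \<beta> A) = 0" for b c
  proof (cases "dart b \<alpha> \<beta> A = 0")
    case False
    then have "A \<noteq> 0" by (auto simp: dart_def)
    then have "\<beta> \<noteq> 0" using False assms dart_eq[of A \<alpha> \<beta> b] by auto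
    then show ?thesis using assms dart_eq[OF False, of "2 * \<alpha>" \<gamma> c] by auto
  qed (simp add: dart_def)
  then have "walk A (RB_route \<alpha> \<beta> \<gamma> A [b]) = walk A [dart b \<alpha> \<beta> A, 0]" for b
    by (simp add: Let_def del: walk.simps add: w)
  then show "RB 1 \<alpha> \<beta> \<gamma> A = oneRB \<alpha> \<beta> A"
    unfolding RB_def oneRB_def replicate_pmf_1 by (simp add: map_pmf_comp del: walk.simps RB_route.simps)
qed

section \<open>Trajectories and expected time for one round of darts\<close>

text \<open>Each dart multiplies the position by a complex number, so the whole route is
  \<open>A\<close> times fixed factors. A turn by \<open>\<alpha>\<close> followed by
  \<open>2 * \<alpha>\<close> back is a net turn by \<open>\<alpha>\<close> to the other side;
  \<open>s\<close> and \<open>r\<close> scale the distance to the centre.\<close>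

lemma RB_route_singleton:
  fixes \<alpha> \<beta> \<gamma> :: real and b :: bool
  assumes A: "A \<noteq> 0" and \<alpha>: "0 < \<alpha>" and \<beta>: "0 \<le> \<beta>" "\<alpha> + \<beta> < pi"
    and \<gamma>: "0 \<le> \<gamma>" "2 * \<alpha> + \<gamma> < pi"
  defines "s \<equiv> sin \<beta> / sin (\<alpha> + \<beta>)" and "r \<equiv> sin \<gamma> / sin (2 * \<alpha> + \<gamma>)"
  defines "p \<equiv> of_real s * cis (if b then \<alpha> else - \<alpha>)"
    and "q \<equiv> of_real (s * r) * cis (if b then - \<alpha> else \<alpha>)"
  shows "RB_route \<alpha> \<beta> \<gamma> A [b] = [p * A, q * A, 0]"
    and "dist A (p * A) = sin \<alpha> / sin (\<alpha> + \<beta>) * norm A"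
    and "dist (p * A) (q * A) = sin (2 * \<alpha>) / sin (2 * \<alpha> + \<gamma>) * s * norm A"
    and "dist (q * A) 0 = s * r * norm A"
proof -
  define P where "P = dart b \<alpha> \<beta> A"
  define Q where "Q = dart (\<not> b) (2 * \<alpha>) \<gamma> P"
  have nn: "0 \<le> s" "0 \<le> r"
    using \<alpha> \<beta> \<gamma> unfolding s_def r_def by (auto intro!: divide_nonneg_nonneg sin_ge_zero)
  have P: "P = p * A"
    unfolding P_def p_def s_def using A \<alpha> \<beta> by (rule dart_eq)
  have normP: "norm P = s * norm A"
    using nn unfolding P p_def by (simp add: norm_mult)
  \<comment> \<open>The closed form of a dart requires a nonzero start; for \<open>P = 0\<close> the
    robot stays and both equations hold trivially.\<close>
  have Q: "Q = of_real r * cis (if b then - (2 * \<alpha>) else 2 * \<alpha>) * P"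
    and PQ: "dist P Q = sin (2 * \<alpha>) / sin (2 * \<alpha> + \<gamma>) * norm P"
    using dart_eq[of P "2 * \<alpha>" \<gamma> "\<not> b"] dist_dart[of P "2 * \<alpha>" \<gamma> "\<not> b"] \<alpha> \<gamma>
    unfolding Q_def r_def by (cases "P = 0"; auto simp: dart_def)+
  have "cis (if b then - (2 * \<alpha>) else 2 * \<alpha>) * cis (if b then \<alpha> else - \<alpha>)
      = cis (if b then - \<alpha> else \<alpha>)"
    by (simp add: cis_mult)
  moreover have "Q = of_real (s * r) * (cis (if b then - (2 * \<alpha>) else 2 * \<alpha>)
      * cis (if b then \<alpha> else - \<alpha>)) * A"
    unfolding Q P p_def of_real_mult by (simp only: mult_ac)
  ultimately have Q': "Q = q * A"
    by (simp add: q_def)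
  show "RB_route \<alpha> \<beta> \<gamma> A [b] = [p * A, q * A, 0]"
    unfolding P[symmetric] Q'[symmetric] by (simp add: P_def Q_def Let_def)
  show "dist A (p * A) = sin \<alpha> / sin (\<alpha> + \<beta>) * norm A"
    unfolding P[symmetric] P_def using A \<alpha> \<beta> by (rule dist_dart)
  show "dist (p * A) (q * A) = sin (2 * \<alpha>) / sin (2 * \<alpha> + \<gamma>) * s * norm A"
    using PQ unfolding P[symmetric] Q'[symmetric] normP by simp
  show "dist (q * A) 0 = s * r * norm A"
    using nn by (simp add: q_def norm_mult)
qed

text \<open>A dart with angle 0 may bring the robot to the centre early. The remaining segments then
  have length 0, so the total length is still the arrival time.\<close>

lemma first_hit_centre:
  assumes "0 < A \<bullet> v" "0 \<le> P \<bullet> v" "0 \<le> Q \<bullet> v"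
    and "P \<bullet> v = 0 \<Longrightarrow> P = 0" "Q \<bullet> v = 0 \<Longrightarrow> Q = 0" "P = 0 \<Longrightarrow> Q = 0"
  shows "first_hit v 0 (walk A [P, Q, 0]) (dist A P + (dist P Q + dist Q 0))"
proof (cases "P = 0")
  case True
  then show ?thesis using first_hit_next[of A v P "[Q, 0]"] assms by simp
next
  case False
  then have P: "0 < P \<bullet> v" using assms by (auto simp: less_le)
  have "first_hit v 0 (walk P [Q, 0]) (dist P Q + dist Q 0)"
  proof (cases "Q = 0")
    case True
    then show ?thesis using first_hit_next[of P v Q "[0]"] P by simp
  next
    case False
    then have "0 < Q \<bullet> v" using assms by (auto simp: less_le)
    then show ?thesis using P by (intro first_hit_step first_hit_next) auto
  qed
  then show ?thesis using first_hit_step[OF assms(1,2)] by blast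
qed

lemma inner_mult_mult_complex: "(c * A) \<bullet> (d * A) = (norm A)\<^sup>2 * Re (c * cnj d)" for A c d :: complex
  unfolding cmod_power2 inner_complex_def by (simp add: algebra_simps power2_eq_square)

text \<open>With \<open>x\<close>, \<open>y\<close>, \<open>z\<close> the lengths of the two darts
  and of the final walk, two coin pairs (equal coins) cost \<open>x + y + z\<close>, one (first
  darts towards each other) costs \<open>x\<close> and one (away from each other) costs
  \<open>x + y\<close>. The average is \<open>x + 3/4 * y + 1/2 * z\<close>.\<close>

lemma expected_time_RB1_ccw:
  fixes \<alpha> \<beta> \<gamma> :: real
  assumes A: "A \<noteq> 0" and B: "B = cis (2 * \<alpha>) * A"
    and \<alpha>: "0 < \<alpha>" "\<alpha> < pi / 4" and \<beta>: "0 \<le> \<beta>" "\<alpha> + \<beta> < pi"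
    and \<gamma>: "0 \<le> \<gamma>" "2 * \<alpha> + \<gamma> < pi"
  shows "expected_time (RB 1 \<alpha> \<beta> \<gamma>) A B = norm A
    * (sin \<alpha> + (3/4 * ((sin (2 * \<alpha>) + 2/3 * sin \<gamma>) / sin (2 * \<alpha> + \<gamma>))) * sin \<beta>) / sin (\<alpha> + \<beta>)"
proof -
  define s where "s = sin \<beta> / sin (\<alpha> + \<beta>)"
  define r where "r = sin \<gamma> / sin (2 * \<alpha> + \<gamma>)"
  define p where "p b = of_real s * cis (if b then \<alpha> else - \<alpha>)" for b
  define q where "q b = of_real (s * r) * cis (if b then - \<alpha> else \<alpha>)" for b
  define x where "x = sin \<alpha> / sin (\<alpha> + \<beta>) * norm A"
  define y where "y = sin (2 * \<alpha>) / sin (2 * \<alpha> + \<gamma>) * s * norm A"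
  define z where "z = s * r * norm A"
  define f where "f C b = walk C (RB_route \<alpha> \<beta> \<gamma> C [b])" for C b
  have nn: "0 \<le> s" "0 \<le> r"
    using \<alpha> \<beta> \<gamma> unfolding s_def r_def by (auto intro!: divide_nonneg_nonneg sin_ge_zero)
  have B0: "B \<noteq> 0" using A B by simp
  have fA: "f A b = walk A [p b * A, q b * A, 0]" and fB: "f B b = walk B [p b * B, q b * B, 0]" for b
    unfolding f_def p_def q_def s_def r_def
    using RB_route_singleton(1)[OF _ \<alpha>(1) \<beta> \<gamma>] A B0 by auto
  have d: "dist A (p b * A) = x" "dist (p b * A) (q b * A) = y" "dist (q b * A) 0 = z" for b
    unfolding x_def y_def z_def p_def q_def s_def r_def
    by (fact RB_route_singleton(2-)[OF A \<alpha>(1) \<beta> \<gamma>])+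
  have cos\<alpha>: "0 < cos \<alpha>" using \<alpha> by (intro cos_gt_zero) auto
  \<comment> \<open>The bound \<open>\<alpha> < pi / 4\<close> keeps \<open>3 * \<alpha>\<close>
    below \<open>pi\<close>. The first inequality places a dart away from the peer strictly on the
    own side of the bisector; the second makes the rotation by \<open>2 * \<alpha>\<close>
    nontrivial.\<close>
  have cos_less: "cos (3 * \<alpha>) < cos \<alpha>" "cos (2 * \<alpha>) < 1"
    using \<alpha> cos_monotone_0_pi[of \<alpha> "3 * \<alpha>"] cos_monotone_0_pi[of 0 "2 * \<alpha>"] by auto
  then have u1: "cis (2 * \<alpha>) \<noteq> 1" by (metis cis.sel(1) less_irrefl one_complex.sel(1))

  have rotate: "f B b t = cis (2 * \<alpha>) * f A b t" for b t
  proof -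
    have "orthogonal_transformation ((*) (cis (2 * \<alpha>)))"
      by (simp add: orthogonal_transformation norm_mult bounded_linear.linear bounded_linear_mult_right)
    from walk_map[OF this, of A "[p b * A, q b * A, 0]" t]
    show ?thesis
      unfolding fA fB unfolding B by (simp only: list.map mult.left_commute mult_zero_right)
  qed
  \<comment> \<open>A nontrivial rotation fixes only the centre, so the two robots are apart while
    the first one lies in the half-plane \<open>0 < w \<bullet> A\<close>.\<close>
  have same: "rendezvous_time (f A b) (f B b) = x + (y + z)" for b
  proof -
    have inner: "(p b * A) \<bullet> A = (norm A)\<^sup>2 * (s * cos \<alpha>)" "(q b * A) \<bullet> A = (norm A)\<^sup>2 * (s * r * cos \<alpha>)"
      using inner_mult_mult_complex[of "p b" A 1] inner_mult_mult_complex[of "q b" A 1]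
      by (auto simp: p_def q_def)
    have "first_hit A 0 (walk A [p b * A, q b * A, 0]) (x + (y + z))"
      unfolding d[of b, symmetric]
    proof (rule first_hit_centre)
      show "0 < A \<bullet> A" "0 \<le> (p b * A) \<bullet> A" "0 \<le> (q b * A) \<bullet> A"
        using A nn cos\<alpha> unfolding inner by auto
      show "(p b * A) \<bullet> A = 0 \<Longrightarrow> p b * A = 0" "(q b * A) \<bullet> A = 0 \<Longrightarrow> q b * A = 0"
        using A cos\<alpha> unfolding inner by (auto simp: p_def q_def)
      show "p b * A = 0 \<Longrightarrow> q b * A = 0"
        by (auto simp: p_def q_def)
    qed
    then have hit: "first_hit A 0 (f A b) (x + (y + z))"
      unfolding fA .
    show ?thesis
    proof (rule rendezvous_time_eq[OF hit])
      show "f A b t \<noteq> f B b t" if "0 < f A b t \<bullet> A" for t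
        using that u1 unfolding rotate by auto
      show "f B b (x + (y + z)) = 0"
        using hit unfolding rotate first_hit_def by simp
    qed
  qed

  \<comment> \<open>Reflection in the bisector of the angle between \<open>A\<close> and
    \<open>B\<close>.\<close>
  define h where "h = (\<lambda>w. cis (2 * \<alpha>) * A / cnj A * cnj w)"
  have h: "orthogonal_transformation h"
    unfolding orthogonal_transformation
  proof (intro conjI allI linearI)
    show "norm (h w) = norm w" for w
      using A by (simp add: h_def norm_mult norm_divide)
  qed (simp_all only: h_def complex_cnj_add distrib_left scaleR_conv_of_real complex_cnj_mult
      complex_cnj_complex_of_real mult.left_commute)
  have hA: "h (c * A) = cnj c * B" for c
    using A by (simp add: h_def B)
  have hAB: "h A = B" "h B = A"
    using hA[of 1] hA[of "cis (2 * \<alpha>)"] by (simp_all add: B cis_cnj cis_mult flip: mult.assoc)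
  \<comment> \<open>Fixed points lie on the bisector, so mirrored robots cannot coincide in the open
    half-plane on the side of \<open>A\<close>.\<close>
  have h_fixed: "w \<bullet> (A - B) = 0" if "h w = w" for w
  proof -
    have "w \<bullet> (A - B) = h w \<bullet> h (A - B)"
      using h by (simp add: orthogonal_transformation_def)
    also have "\<dots> = w \<bullet> (B - A)"
      using linear_diff[OF orthogonal_transformation_linear[OF h]] by (simp add: that hAB)
    finally show ?thesis by (simp add: inner_diff_right)
  qed
  have mirror: "f B (\<not> b) t = h (f A b t)" for b t
  proof -
    have "h 0 = 0" "p (\<not> b) = cnj (p b)" "q (\<not> b) = cnj (q b)"
      by (auto simp: h_def p_def q_def cis_cnj)
    then show ?thesis
      using walk_map[OF h, of A "[p b * A, q b * A, 0]" t] unfolding fA fB list.map hA hAB by simp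
  qed
  \<comment> \<open>Measures the side of the bisector for a point at angle \<open>\<theta>\<close>
    from \<open>A\<close>: the value vanishes at \<open>\<theta> = \<alpha>\<close>, and for
    \<open>c > 0\<close> it is positive at \<open>0\<close> and at
    \<open>- \<alpha>\<close>.\<close>
  have inner: "(of_real c * cis \<theta> * A) \<bullet> (A - B) = (norm A)\<^sup>2 * (c * (cos \<theta> - cos (\<theta> - 2 * \<alpha>)))"
    for c \<theta>
    using inner_mult_mult_complex[of "of_real c * cis \<theta>" A "1 - cis (2 * \<alpha>)"]
    unfolding B by (simp add: algebra_simps cos_diff)
  have A_pos: "0 < A \<bullet> (A - B)"
    using inner[of 1 0] A cos_less by simp
  have opposite: "rendezvous_time (f A b) (f B (\<not> b)) = T" if "first_hit (A - B) z (f A b) T" "h z = z" for b z T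
    using that(1)
  proof (rule rendezvous_time_eq)
    show "f A b t \<noteq> f B (\<not> b) t" if "0 < f A b t \<bullet> (A - B)" for t
      using that h_fixed[of "f A b t"] unfolding mirror by auto
    show "f B (\<not> b) T = z"
      using that by (simp add: mirror first_hit_def)
  qed
  have fixed: "h (of_real c * cis \<alpha> * A) = of_real c * cis \<alpha> * A" for c
    unfolding hA by (simp add: B cis_cnj cis_mult flip: mult.assoc)
  have towards: "rendezvous_time (f A True) (f B False) = x"
  proof -
    have "(p True * A) \<bullet> (A - B) = 0"
      unfolding p_def by (simp add: inner)
    then have "first_hit (A - B) (p True * A) (f A True) x"
      using first_hit_next[OF A_pos, of "p True * A"] unfolding fA d by simp
    moreover have "h (p True * A) = p True * A"
      by (simp add: p_def fixed)
    ultimately show ?thesis using opposite[of "p True * A" True x] by simp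
  qed
  have away: "rendezvous_time (f A False) (f B True) = x + y"
  proof -
    have P: "(p False * A) \<bullet> (A - B) = (norm A)\<^sup>2 * (s * (cos \<alpha> - cos (3 * \<alpha>)))"
      using inner[of s "- \<alpha>"] cos_minus[of "3 * \<alpha>"] unfolding p_def by simp
    have Q: "(q False * A) \<bullet> (A - B) = 0"
      using inner[of "s * r" \<alpha>] unfolding q_def by simp
    \<comment> \<open>If \<open>s = 0\<close>, the first dart already ends on the boundary line, at
      the centre, and the second has length 0. Otherwise its end is strictly inside and two segments
      are chained.\<close>
    have "first_hit (A - B) (q False * A) (f A False) (x + y)"
    proof (cases "s = 0")
      case True
      then have pq: "q False * A = p False * A" and "y = 0" by (simp_all add: p_def q_def y_def)
      then show ?thesis
        using first_hit_next[OF A_pos, of "p False * A"] Q d(1)[of False] unfolding fA pq by simp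
    next
      case False
      then have "0 < (p False * A) \<bullet> (A - B)" using P A nn cos_less by simp
      then show ?thesis using Q A_pos unfolding fA d[of False, symmetric]
        by (intro first_hit_step first_hit_next) auto
    qed
    moreover have "h (q False * A) = q False * A"
      unfolding q_def if_False by (rule fixed)
    ultimately show ?thesis using opposite[of "q False * A" False "x + y"] by simp
  qed
  have "expected_time (RB 1 \<alpha> \<beta> \<gamma>) A B = x + 3/4 * y + 1/2 * z"
    unfolding expected_time_RB1 f_def[symmetric]
    by (simp add: UNIV_bool same towards away)
  also have "\<dots> = norm A * (sin \<alpha> + (3/4 * ((sin (2 * \<alpha>) + 2/3 * sin \<gamma>) / sin (2 * \<alpha> + \<gamma>))) * sin \<beta>) / sin (\<alpha> + \<beta>)"
    unfolding x_def y_def z_def s_def r_def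
    by (simp add: add_divide_distrib distrib_left distrib_right mult_ac)
  finally show ?thesis .
qed

section \<open>Instances given by their radius\<close>

lemma arcsin_inverse_radius:
  assumes "sqrt 2 < \<rho>"
  shows "sin (arcsin (1 / \<rho>)) = 1 / \<rho>" "0 < arcsin (1 / \<rho>)" "arcsin (1 / \<rho>) < pi / 4"
    and "cos (arcsin (1 / \<rho>)) = sqrt (\<rho>\<^sup>2 - 1) / \<rho>"
proof -
  have \<rho>: "1 < \<rho>" using assms less_trans[of 1 "sqrt 2" \<rho>] by simp
  then have b: "-1 < 1 / \<rho>" "1 / \<rho> < 1" using less_trans[of "-1" 0 "1 / \<rho>"] by auto
  then show s: "sin (arcsin (1 / \<rho>)) = 1 / \<rho>" by simp
  show "0 < arcsin (1 / \<rho>)"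
    using arcsin_less_arcsin[of 0 "1 / \<rho>"] b \<rho> by simp
  have "1 / \<rho> < 1 / sqrt 2" using assms \<rho> by (intro divide_strict_left_mono) auto
  also have "\<dots> = sqrt 2 / 2" by (simp add: field_simps)
  finally have "sin (arcsin (1 / \<rho>)) < sin (pi / 4)"
    unfolding s sin_45 .
  then show "arcsin (1 / \<rho>) < pi / 4"
    using arcsin_bounded[of "1 / \<rho>"] b sin_mono_less_eq[of "arcsin (1 / \<rho>)" "pi / 4"] by simp
  have "cos (arcsin (1 / \<rho>)) = sqrt (1 - (1 / \<rho>)\<^sup>2)"
    using b by (intro cos_arcsin) auto
  also have "1 - (1 / \<rho>)\<^sup>2 = (\<rho>\<^sup>2 - 1) / \<rho>\<^sup>2"
    using \<rho> by (simp add: field_simps)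
  finally show "cos (arcsin (1 / \<rho>)) = sqrt (\<rho>\<^sup>2 - 1) / \<rho>"
    using \<rho> by (simp add: real_sqrt_divide)
qed

text \<open>The quotient \<open>B / A\<close> has modulus 1 and distance
  \<open>2 * sin \<alpha>\<close> from 1, which fixes it up to conjugation. The clockwise case
  reduces to the counterclockwise one by exchanging the robots.\<close>

lemma expected_time_RB1_SRD:
  fixes \<rho> \<beta> \<gamma> :: real
  defines "\<alpha> \<equiv> arcsin (1 / \<rho>)"
  assumes \<rho>: "sqrt 2 < \<rho>" and AB: "SRD \<rho> A B" and \<beta>: "0 \<le> \<beta>" "\<alpha> + \<beta> < pi"
    and \<gamma>: "0 \<le> \<gamma>" "2 * \<alpha> + \<gamma> < pi"
  shows "expected_time (RB 1 \<alpha> \<beta> \<gamma>) A B = \<rho>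
    * (sin \<alpha> + (3/4 * ((sin (2 * \<alpha>) + 2/3 * sin \<gamma>) / sin (2 * \<alpha> + \<gamma>))) * sin \<beta>) / sin (\<alpha> + \<beta>)"
proof -
  note \<alpha> = arcsin_inverse_radius[OF \<rho>, folded \<alpha>_def]
  note sin\<alpha> = \<alpha>(1)
  have \<rho>1: "1 < \<rho>" using \<rho> less_trans[of 1 "sqrt 2" \<rho>] by simp
  have nA: "norm A = \<rho>" "norm B = \<rho>" "A \<noteq> 0" "B \<noteq> 0" "norm (A - B) = 2"
    using AB \<rho>1 by (auto simp: SRD_def dist_norm)
  define u where "u = B / A"
  have u: "norm u = 1" "B = u * A" using nA \<rho>1 by (auto simp: u_def norm_divide)
  have "norm (1 - u) * norm A = 2"
    using nA(5) unfolding u(2) norm_mult[symmetric] by (simp add: left_diff_distrib)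
  then have "norm (1 - u) = 2 * sin \<alpha>"
    using \<rho>1 by (simp add: nA sin\<alpha> field_simps)
  then have "(1 - Re u)\<^sup>2 + (Im u)\<^sup>2 = 4 * (sin \<alpha>)\<^sup>2"
    using cmod_power2[of "1 - u"] by (simp add: power_mult_distrib)
  moreover have nu: "(Re u)\<^sup>2 + (Im u)\<^sup>2 = 1" using u cmod_power2[of u] by simp
  ultimately have Re: "Re u = cos (2 * \<alpha>)"
    unfolding cos_double_sin by (simp add: power2_eq_square algebra_simps)
  then have "(Im u)\<^sup>2 = (sin (2 * \<alpha>))\<^sup>2"
    using nu by (simp add: sin_squared_eq)
  then have "Im u = sin (2 * \<alpha>) \<or> Im u = - sin (2 * \<alpha>)"
    by (simp add: power2_eq_iff)
  then consider "u = cis (2 * \<alpha>)" | "u = cis (- (2 * \<alpha>))"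
    using Re by (auto simp: complex_eq_iff)
  then show ?thesis
  proof cases
    case 1
    then show ?thesis
      using expected_time_RB1_ccw[OF nA(3), of B \<alpha> \<beta> \<gamma>] u(2) \<alpha> \<beta> \<gamma> nA by simp
  next
    case 2
    then have "A = cis (2 * \<alpha>) * B"
      unfolding u(2) by (simp add: cis_mult flip: mult.assoc)
    then show ?thesis
      using expected_time_RB1_ccw[OF nA(4), of A \<alpha> \<beta> \<gamma>] expected_time_commute[of _ A B] \<alpha> \<beta> \<gamma> nA by simp
  qed
qed

section \<open>Minimisation over the two dart angles\<close>

text \<open>With \<open>g = cos (\<phi> + z)\<close> the numerator equals
  \<open>cos z * sin (\<phi> + y) + sin \<phi> * (1 - cos (y - z))\<close>, so the excess over
  \<open>cos z\<close> is nonnegative and vanishes only at \<open>y = z\<close>. If \<open>z\<close>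
  would be negative, then \<open>g > cos \<phi>\<close>, and the numerator exceeds
  \<open>sin (\<phi> + y)\<close> unless \<open>y = 0\<close>.\<close>

lemma dart_profile_min:
  assumes \<phi>: "0 < \<phi>" and g: "-1 \<le> g" "g \<le> 1" and y: "0 \<le> y" "\<phi> + y < pi"
  defines "y0 \<equiv> max 0 (arccos g - \<phi>)"
  defines "H \<equiv> (sin \<phi> + g * sin y) / sin (\<phi> + y)"
  shows "cos y0 \<le> H" and "H = cos y0 \<longleftrightarrow> y = y0"
proof -
  have pos: "0 < sin (\<phi> + y)" "0 < sin \<phi>"
    using \<phi> y by (auto intro!: sin_gt_zero)
  have cos_less: "cos x < 1" if "x \<noteq> 0" "\<bar>x\<bar> < 2 * pi" for x
  proof -
    have "sin (x / 2) \<noteq> 0"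
      using that sin_gt_zero[of "\<bar>x\<bar> / 2"] by (cases "x \<ge> 0") auto
    then have "0 < (sin (x / 2))\<^sup>2" by simp
    moreover have "cos x = 1 - 2 * (sin (x / 2))\<^sup>2"
      using cos_double_sin[of "x / 2"] by simp
    ultimately show ?thesis by linarith
  qed
  have "cos y0 \<le> H \<and> (H = cos y0 \<longleftrightarrow> y = y0)"
  proof (cases "\<phi> \<le> arccos g")
    case True
    define z where "z = arccos g - \<phi>"
    have y0: "y0 = z" and z: "0 \<le> z" "z \<le> pi" using True g \<phi> arccos_ubound[of g] by (auto simp: y0_def z_def)
    have g': "g = cos (\<phi> + z)" using g by (simp add: z_def)
    have "sin \<phi> + g * sin y = cos z * sin (\<phi> + y) + sin \<phi> * (1 - cos (y - z))"
      unfolding g' by (simp add: sin_add cos_add cos_diff algebra_simps)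
    then have H: "H = cos z + sin \<phi> * (1 - cos (y - z)) / sin (\<phi> + y)"
      unfolding H_def using pos by (simp add: field_simps)
    show ?thesis
    proof (cases "y = z")
      case False
      have "\<bar>y - z\<bar> < 2 * pi" using y z \<phi> by linarith
      then have "0 < sin \<phi> * (1 - cos (y - z)) / sin (\<phi> + y)"
        using cos_less[of "y - z"] False pos by auto
      then show ?thesis using False unfolding H y0 by linarith
    qed (use H y0 in simp)
  next
    case False
    then have y0: "y0 = 0" by (simp add: y0_def)
    have "cos \<phi> < cos (arccos g)"
      using False g \<phi> y by (intro cos_monotone_0_pi) (auto simp: arccos_lbound)
    then have gc: "cos \<phi> < g" using g by simp
    show ?thesis
    proof (cases "y = 0")
      case True
      then show ?thesis using y0 pos by (simp add: H_def)
    next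
      case y': False
      then have "0 < sin y" using y \<phi> by (intro sin_gt_zero) auto
      then have "0 < (g - cos \<phi>) * sin y" using gc by simp
      moreover have "0 < sin \<phi> * (1 - cos y)"
        using cos_less[of y] y' y \<phi> pos by auto
      moreover have "sin \<phi> + g * sin y - sin (\<phi> + y) = sin \<phi> * (1 - cos y) + (g - cos \<phi>) * sin y"
        by (simp add: sin_add algebra_simps)
      ultimately have "1 < H" unfolding H_def using pos by simp
      then show ?thesis using y0 y' by simp
    qed
  qed
  then show "cos y0 \<le> H" and "H = cos y0 \<longleftrightarrow> y = y0" by auto
qed

text \<open>The angle \<open>\<gamma>\<close> enters only through the factor \<open>G\<close>, whose
  weight is a nonnegative multiple of \<open>sin \<beta>\<close>. So \<open>G\<close> is minimised
  first and \<open>\<beta>\<close> afterwards. For \<open>\<beta> = 0\<close> the weight vanishes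
  and \<open>\<gamma>\<close> is arbitrary, which explains the disjunction.\<close>

lemma RB1_cost_min:
  fixes \<rho> \<alpha> \<beta> \<gamma> :: real
  assumes \<rho>: "0 < \<rho>" and \<alpha>: "0 < \<alpha>" and \<beta>: "0 \<le> \<beta>" "\<alpha> + \<beta> < pi" and \<gamma>: "0 \<le> \<gamma>" "2 * \<alpha> + \<gamma> < pi"
  defines "\<gamma>0 \<equiv> max 0 (arccos (2/3) - 2 * \<alpha>)"
  defines "\<beta>0 \<equiv> max 0 (arccos (3/4 * cos \<gamma>0) - \<alpha>)"
  defines "E \<equiv> \<rho> * (sin \<alpha> + (3/4 * ((sin (2*\<alpha>) + 2/3 * sin \<gamma>) / sin (2*\<alpha> + \<gamma>))) * sin \<beta>) / sin (\<alpha> + \<beta>)"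
  shows "\<rho> * cos \<beta>0 \<le> E" and "E = \<rho> * cos \<beta>0 \<longleftrightarrow> \<beta> = \<beta>0 \<and> (\<beta>0 = 0 \<or> \<gamma> = \<gamma>0)"
proof -
  define G where "G = (sin (2*\<alpha>) + 2/3 * sin \<gamma>) / sin (2*\<alpha> + \<gamma>)"
  define F where "F g = (sin \<alpha> + g * sin \<beta>) / sin (\<alpha> + \<beta>)" for g
  have pos: "0 < sin (\<alpha> + \<beta>)" "0 \<le> sin \<beta>"
    using \<alpha> \<beta> by (auto intro!: sin_gt_zero sin_ge_zero)
  have sinb: "0 < sin \<beta>" if "\<beta> \<noteq> 0" using that \<alpha> \<beta> by (intro sin_gt_zero) auto
  have G: "cos \<gamma>0 \<le> G" "G = cos \<gamma>0 \<longleftrightarrow> \<gamma> = \<gamma>0"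
    unfolding G_def \<gamma>0_def using \<alpha> \<gamma> dart_profile_min[of "2 * \<alpha>" "2/3" \<gamma>] by auto
  have c34: "-1 \<le> 3/4 * cos \<gamma>0" "3/4 * cos \<gamma>0 \<le> 1"
    using cos_ge_minus_one[of \<gamma>0] cos_le_one[of \<gamma>0] by linarith+
  have F: "cos \<beta>0 \<le> F (3/4 * cos \<gamma>0)" "F (3/4 * cos \<gamma>0) = cos \<beta>0 \<longleftrightarrow> \<beta> = \<beta>0"
    unfolding F_def \<beta>0_def using \<alpha> \<beta> c34
      by - (intro dart_profile_min; assumption)+
  have diff: "F (3/4 * G) - F (3/4 * cos \<gamma>0) = 3/4 * (G - cos \<gamma>0) * sin \<beta> / sin (\<alpha> + \<beta>)"
    unfolding F_def using pos by (simp add: field_simps)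
  moreover have nn: "0 \<le> 3/4 * (G - cos \<gamma>0) * sin \<beta> / sin (\<alpha> + \<beta>)"
    using G(1) pos by (intro divide_nonneg_nonneg mult_nonneg_nonneg) auto
  ultimately have FG: "F (3/4 * cos \<gamma>0) \<le> F (3/4 * G)" by linarith
  have eq: "F (3/4 * G) = F (3/4 * cos \<gamma>0) \<longleftrightarrow> \<beta> = 0 \<or> \<gamma> = \<gamma>0"
    using diff pos sinb G(2) by force
  have E: "E = \<rho> * F (3/4 * G)" by (simp add: E_def F_def G_def)
  show "\<rho> * cos \<beta>0 \<le> E"
    using FG F(1) \<rho> unfolding E by simp
  have "F (3/4 * G) = cos \<beta>0 \<longleftrightarrow> F (3/4 * G) = F (3/4 * cos \<gamma>0) \<and> F (3/4 * cos \<gamma>0) = cos \<beta>0"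
    using FG F(1) by linarith
  then show "E = \<rho> * cos \<beta>0 \<longleftrightarrow> \<beta> = \<beta>0 \<and> (\<beta>0 = 0 \<or> \<gamma> = \<gamma>0)"
    unfolding E using \<rho> eq F(2) by auto
qed

section \<open>Optimal parameters and the threshold radius\<close>

text \<open>Half-angle formula: the squared sine is \<open>(1 - 2/3) / 2 = 1/6\<close>.\<close>

lemma rho_threshold_eq: "rho_threshold = sqrt 6"
proof -
  have "0 \<le> sin (1/2 * arccos (2/3))"
    using arccos_lbound[of "2/3"] arccos_ubound[of "2/3"] by (intro sin_ge_zero) auto
  moreover have "(sin (1/2 * arccos (2/3)))\<^sup>2 = 1/6"
    using cos_double_sin[of "1/2 * arccos (2/3)"] by simp
  ultimately have "sin (1/2 * arccos (2/3)) = sqrt (1/6)"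
    by (metis real_sqrt_unique)
  then show ?thesis
    by (simp add: rho_threshold_def real_sqrt_divide)
qed

lemma is_arg_min_iff_attained:
  fixes f :: "'a \<Rightarrow> 'b :: order"
  assumes "\<And>y. P y \<Longrightarrow> m \<le> f y" and "P w" "f w = m"
  shows "is_arg_min f P x \<longleftrightarrow> P x \<and> f x = m"
  using assms unfolding is_arg_min_def by (metis order_le_less order_less_le_trans order_less_irrefl)

text \<open>For \<open>\<gamma>0 = 0\<close> the minimal cost is attained within the subfamily
  \<open>\<gamma> = 0\<close>, which is \<open>oneRB\<close>; the same lower bound therefore settles
  both optimisation problems.\<close>

lemma optimal_iff:
  fixes \<rho> :: real
  assumes \<rho>: "sqrt 2 < \<rho>" and AB: "SRD \<rho> A B"
  defines "\<alpha> \<equiv> arcsin (1 / \<rho>)"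
  defines "\<gamma>0 \<equiv> max 0 (arccos (2/3) - 2 * \<alpha>)"
  defines "\<beta>0 \<equiv> max 0 (arccos (3/4 * cos \<gamma>0) - \<alpha>)"
  shows "optimal_RB1 \<rho> A B (\<beta>, \<gamma>) \<longleftrightarrow>
      \<beta> = \<beta>0 \<and> \<gamma> \<in> {0..pi/2 - \<alpha>} \<and> (\<beta>0 = 0 \<or> \<gamma> = \<gamma>0)"
    and "expected_time (RB 1 \<alpha> \<beta>0 \<gamma>0) A B = \<rho> * cos \<beta>0"
    and "\<gamma>0 = 0 \<Longrightarrow> optimal_oneRB \<rho> A B \<beta> \<longleftrightarrow> \<beta> = \<beta>0"
proof -
  note \<alpha> = arcsin_inverse_radius(2,3)[OF \<rho>, folded \<alpha>_def]
  have \<rho>0: "0 < \<rho>" using \<rho> less_trans[of 0 "sqrt 2" \<rho>] by simp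
  have cost: "\<rho> * cos \<beta>0 \<le> expected_time (RB 1 \<alpha> b g) A B"
    "expected_time (RB 1 \<alpha> b g) A B = \<rho> * cos \<beta>0 \<longleftrightarrow> b = \<beta>0 \<and> (\<beta>0 = 0 \<or> g = \<gamma>0)"
    if "0 \<le> b" "\<alpha> + b < pi" "0 \<le> g" "2 * \<alpha> + g < pi" for b g
    using RB1_cost_min[OF \<rho>0 \<alpha>(1) that] that \<alpha>
    unfolding \<beta>0_def \<gamma>0_def \<alpha>_def by (simp_all only: expected_time_RB1_SRD[OF \<rho> AB])
  \<comment> \<open>From here to the bounds on \<open>\<beta>0\<close>: the minimiser over the
    larger range of angles lies in the prescribed square.\<close>
  have "arccos (2/3) \<le> pi / 2"
    using arccos_le_pi2[of "2/3"] by simp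
  then have \<gamma>0: "0 \<le> \<gamma>0" "\<gamma>0 \<le> pi/2 - \<alpha>" using \<alpha> by (auto simp: \<gamma>0_def)
  then have "0 \<le> cos \<gamma>0" using \<alpha> by (intro cos_ge_zero) auto
  then have "arccos (3/4 * cos \<gamma>0) \<le> pi / 2"
    using cos_le_one[of \<gamma>0] by (intro arccos_le_pi2) linarith+
  then have \<beta>0: "0 \<le> \<beta>0" "\<beta>0 \<le> pi/2 - \<alpha>" using \<alpha> by (auto simp: \<beta>0_def)
  show val: "expected_time (RB 1 \<alpha> \<beta>0 \<gamma>0) A B = \<rho> * cos \<beta>0"
    using cost(2)[of \<beta>0 \<gamma>0] \<beta>0 \<gamma>0 \<alpha> by simp
  have "optimal_RB1 \<rho> A B (\<beta>, \<gamma>) \<longleftrightarrow> (\<beta>, \<gamma>) \<in> {0..pi/2 - \<alpha>} \<times> {0..pi/2 - \<alpha>} \<and>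
      expected_time (RB 1 \<alpha> \<beta> \<gamma>) A B = \<rho> * cos \<beta>0"
    unfolding optimal_RB1_def \<alpha>_def[symmetric]
    by (subst is_arg_min_iff_attained[where m = "\<rho> * cos \<beta>0" and w = "(\<beta>0, \<gamma>0)"])
      (use cost(1) \<alpha> \<beta>0 \<gamma>0 val in auto)
  then show "optimal_RB1 \<rho> A B (\<beta>, \<gamma>) \<longleftrightarrow>
      \<beta> = \<beta>0 \<and> \<gamma> \<in> {0..pi/2 - \<alpha>} \<and> (\<beta>0 = 0 \<or> \<gamma> = \<gamma>0)"
    using cost(2)[of \<beta> \<gamma>] \<alpha> \<beta>0 by auto
  assume g0: "\<gamma>0 = 0"
  have one: "expected_time (oneRB \<alpha> b) A B = expected_time (RB 1 \<alpha> b 0) A B" if "b \<in> {0..<pi/2}" for b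
    using RB1_eq_oneRB[of \<alpha> b 0] \<alpha> that by simp
  have "optimal_oneRB \<rho> A B \<beta> \<longleftrightarrow> \<beta> \<in> {0..<pi/2} \<and> expected_time (oneRB \<alpha> \<beta>) A B = \<rho> * cos \<beta>0"
    unfolding optimal_oneRB_def \<alpha>_def[symmetric]
    by (rule is_arg_min_iff_attained[where w = \<beta>0]) (use one cost(1)[of _ 0] \<alpha> \<beta>0 val g0 in auto)
  then show "optimal_oneRB \<rho> A B \<beta> \<longleftrightarrow> \<beta> = \<beta>0"
    using cost(2)[of \<beta> 0] one[of \<beta>] \<alpha> \<beta>0 g0 by auto
qed

text \<open>Both sides compare \<open>arcsin (1 / \<rho>)\<close> with half of
  \<open>arccos (2/3)\<close>, the left one through the sine, which is increasing there.\<close>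

lemma rho_threshold_less_iff:
  assumes "sqrt 2 < \<rho>"
  shows "\<rho> < rho_threshold \<longleftrightarrow> gamma_opt \<rho> < 0"
proof -
  define t where "t = 1/2 * arccos (2/3)"
  have t: "0 < t" "t < pi / 2"
    using arccos_lt_bounded[of "2/3"] by (auto simp: t_def)
  then have "0 < sin t" by (intro sin_gt_zero) auto
  have \<rho>0: "0 < \<rho>" using assms less_trans[of 0 "sqrt 2" \<rho>] by simp
  note \<alpha> = arcsin_inverse_radius[OF assms]
  have "\<rho> < rho_threshold \<longleftrightarrow> sin t < sin (arcsin (1 / \<rho>))"
    unfolding rho_threshold_def t_def[symmetric] \<alpha>(1) using \<rho>0 \<open>0 < sin t\<close> by (simp add: field_simps)
  also have "\<dots> \<longleftrightarrow> t < arcsin (1 / \<rho>)"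
    using t \<alpha>(2,3) by (intro sin_mono_less_eq) auto
  finally show ?thesis by (auto simp: t_def gamma_opt_def)
qed

section \<open>Closed form of the optimal cost, its growth and its numerical bounds\<close>

text \<open>Addition formula; \<open>sqrt 5\<close> comes from
  \<open>sin (arccos (2/3)) = sqrt 5 / 3\<close>.\<close>

lemma cos_gamma_opt:
  assumes "sqrt 2 < \<rho>"
  shows "3/4 * cos (gamma_opt \<rho>) = (\<rho>\<^sup>2 - 2 + sqrt 5 * sqrt (\<rho>\<^sup>2 - 1)) / (2 * \<rho>\<^sup>2)"
proof -
  have \<rho>0: "0 < \<rho>" using assms less_trans[of 0 "sqrt 2" \<rho>] by simp
  note \<alpha> = arcsin_inverse_radius[OF assms]
  have s: "sin (arccos (2/3)) = sqrt 5 / 3"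
    by (simp add: sin_arccos power2_eq_square real_sqrt_divide)
  have eq: "cos (gamma_opt \<rho>) = 2/3 * (1 - 2 * (1 / \<rho>)\<^sup>2) + sqrt 5 / 3 * (2 * (1 / \<rho>) * (sqrt (\<rho>\<^sup>2 - 1) / \<rho>))"
    unfolding gamma_opt_def cos_diff s cos_double_sin sin_double \<alpha>(1,4) by simp
  show ?thesis unfolding eq using \<rho>0 by (simp add: field_simps power2_eq_square)
qed

text \<open>This is \<open>g * sqrt (\<rho>\<^sup>2 - 1) + sqrt (1 - g\<^sup>2)\<close> with
  \<open>g = 3/4 * cos (gamma_opt \<rho>)\<close>, the expansion of
  \<open>\<rho> * cos (arccos g - arcsin (1 / \<rho>))\<close>. The terms are grouped so that each
  is monotone above the threshold.\<close>

definition RB1_value :: "real \<Rightarrow> real" where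
  "RB1_value \<rho> = (sqrt (\<rho>\<^sup>2 - 1) * (1 - 2 / \<rho>\<^sup>2) + sqrt 5 * (1 - 1 / \<rho>\<^sup>2)) / 2
    + sqrt (1 - ((\<rho>\<^sup>2 - 2 + sqrt 5 * sqrt (\<rho>\<^sup>2 - 1)) / (2 * \<rho>\<^sup>2))\<^sup>2)"

lemma rho_cos_beta_opt:
  assumes "sqrt 2 < \<rho>"
  shows "\<rho> * cos (beta_opt \<rho>) = RB1_value \<rho>"
proof -
  have \<rho>: "1 < \<rho>" using assms less_trans[of 1 "sqrt 2" \<rho>] by simp
  then have \<rho>2: "1 < \<rho>\<^sup>2" by simp
  note \<alpha> = arcsin_inverse_radius[OF assms]
  define g where "g = 3/4 * cos (gamma_opt \<rho>)"
  have g: "-1 \<le> g" "g \<le> 1"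
    unfolding g_def using cos_ge_minus_one[of "gamma_opt \<rho>"] cos_le_one[of "gamma_opt \<rho>"] by linarith+
  have "cos (beta_opt \<rho>) = g * (sqrt (\<rho>\<^sup>2 - 1) / \<rho>) + sqrt (1 - g\<^sup>2) * (1 / \<rho>)"
    unfolding beta_opt_def gamma_opt_def[symmetric] g_def[symmetric] cos_diff \<alpha>(1,4)
    using g by (simp add: sin_arccos)
  then have "\<rho> * cos (beta_opt \<rho>) = g * sqrt (\<rho>\<^sup>2 - 1) + sqrt (1 - g\<^sup>2)"
    using \<rho> by (simp add: field_simps)
  moreover have "g * sqrt (\<rho>\<^sup>2 - 1) = (sqrt (\<rho>\<^sup>2 - 1) * (1 - 2 / \<rho>\<^sup>2) + sqrt 5 * (1 - 1 / \<rho>\<^sup>2)) / 2"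
  proof -
    have "sqrt (\<rho>\<^sup>2 - 1) * sqrt (\<rho>\<^sup>2 - 1) = \<rho>\<^sup>2 - 1" using \<rho>2 by simp
    then have "(\<rho>\<^sup>2 - 2 + sqrt 5 * sqrt (\<rho>\<^sup>2 - 1)) * sqrt (\<rho>\<^sup>2 - 1)
        = (\<rho>\<^sup>2 - 2) * sqrt (\<rho>\<^sup>2 - 1) + sqrt 5 * (\<rho>\<^sup>2 - 1)"
      by (simp add: distrib_right mult.assoc)
    then show ?thesis
      unfolding g_def cos_gamma_opt[OF assms] using \<rho> by (simp add: field_simps)
  qed
  ultimately show ?thesis
    unfolding RB1_value_def cos_gamma_opt[OF assms, symmetric] g_def by simp
qed

lemma RB1_value_eq:
  assumes "1 < \<rho>"
  shows "RB1_value \<rho> = 1/2 * (- (sqrt 5 / \<rho>^2) + sqrt (\<rho>^2 - 1) - 2 * sqrt (\<rho>^2 - 1) / \<rho>^2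
    + 2 * sqrt (1 - (\<rho> * (sqrt (5 - 5/\<rho>^2) + \<rho>) - 2)^2 / (4 * \<rho>^4)) + sqrt 5)"
proof -
  have "5 - 5 / \<rho>\<^sup>2 = 5 * (\<rho>\<^sup>2 - 1) / \<rho>\<^sup>2"
    using assms by (simp add: field_simps)
  then have "sqrt (5 - 5 / \<rho>\<^sup>2) = sqrt 5 * sqrt (\<rho>\<^sup>2 - 1) / sqrt (\<rho>\<^sup>2)"
    by (simp only: real_sqrt_divide real_sqrt_mult)
  then have "sqrt (5 - 5 / \<rho>\<^sup>2) = sqrt 5 * sqrt (\<rho>\<^sup>2 - 1) / \<rho>"
    using assms by simp
  then have "\<rho> * (sqrt (5 - 5/\<rho>\<^sup>2) + \<rho>) - 2 = \<rho>\<^sup>2 - 2 + sqrt 5 * sqrt (\<rho>\<^sup>2 - 1)"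
    using assms by (simp add: field_simps power2_eq_square)
  then show ?thesis
    unfolding RB1_value_def power_divide by (simp add: power_mult_distrib algebra_simps add_divide_distrib diff_divide_distrib)
qed

text \<open>The first two terms increase strictly. For the root, \<open>gamma_opt\<close> grows
  inside \<open>[0, pi / 2]\<close>, so its cosine falls while staying nonnegative, and
  \<open>sqrt (1 - g\<^sup>2)\<close> does not decrease.\<close>

lemma RB1_value_strict_mono:
  assumes "rho_threshold \<le> x" "x < y"
  shows "RB1_value x < RB1_value y"
proof -
  have "sqrt 2 < rho_threshold" by (simp add: rho_threshold_eq)
  then have x: "sqrt 2 < x" and y: "sqrt 2 < y" using assms by auto
  then have x1: "1 < x" using less_trans[of 1 "sqrt 2" x] by simp
  have "(sqrt 2)\<^sup>2 < x\<^sup>2" using x by (intro power_strict_mono) auto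
  then have x2: "2 < x\<^sup>2" by simp
  have xy: "x\<^sup>2 < y\<^sup>2" using assms x1 by (intro power_strict_mono) auto
  have "2 / y\<^sup>2 < 2 / x\<^sup>2"
    using x2 xy by (intro divide_strict_left_mono mult_pos_pos) auto
  moreover have "2 / x\<^sup>2 < 1" using x2 by (subst divide_less_eq_1_pos) auto
  ultimately have "sqrt (x\<^sup>2 - 1) * (1 - 2 / x\<^sup>2) < sqrt (y\<^sup>2 - 1) * (1 - 2 / y\<^sup>2)"
    using x2 xy by (intro mult_strict_mono) auto
  moreover have "sqrt 5 * (1 - 1 / x\<^sup>2) < sqrt 5 * (1 - 1 / y\<^sup>2)"
    using x2 xy
    by (intro mult_strict_left_mono diff_strict_left_mono divide_strict_left_mono mult_pos_pos) auto
  moreover have "sqrt (1 - (3/4 * cos (gamma_opt x))\<^sup>2) \<le> sqrt (1 - (3/4 * cos (gamma_opt y))\<^sup>2)"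
  proof -
    have "1 / y < 1 / x" using assms x1 by (simp add: field_simps)
    moreover have "1 / x < 1" "-1 < 1 / y" using assms x1 less_trans[of "-1" 0 "1 / y"] by auto
    ultimately have "arcsin (1 / y) < arcsin (1 / x)"
      by (intro arcsin_less_arcsin) auto
    moreover have "0 \<le> gamma_opt x"
      using rho_threshold_less_iff[OF x] assms by linarith
    moreover have "arccos (2/3) \<le> pi / 2"
      using arccos_le_pi2[of "2/3"] by simp
    moreover have "0 < arcsin (1 / y)" by (rule arcsin_inverse_radius[OF y])
    ultimately have g: "0 \<le> gamma_opt x" "gamma_opt x \<le> gamma_opt y" "gamma_opt y \<le> pi / 2"
      by (auto simp: gamma_opt_def)
    then have "0 \<le> cos (gamma_opt y)" "cos (gamma_opt y) \<le> cos (gamma_opt x)"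
      by (auto intro!: cos_ge_zero cos_monotone_0_pi_le)
    then show ?thesis by (simp add: power_mono)
  qed
  ultimately show ?thesis
    unfolding RB1_value_def cos_gamma_opt[OF x, symmetric] cos_gamma_opt[OF y, symmetric]
    by (intro add_less_le_mono divide_strict_right_mono add_strict_mono) auto
qed

text \<open>The endpoints are 5.32366 plus and minus 0.000005. Decimal enclosures of the roots
  suffice, with opposite directions for \<open>c\<close> and \<open>sqrt (1 - c\<^sup>2)\<close>. At
  the left endpoint the margin is only about 1.3e-7, hence the longer decimals there.\<close>

lemma RB1_value_bracket: "RB1_value 5.323655 \<le> 4.25" "4.25 \<le> RB1_value 5.323665"
proof -
  have sqrt5: "2.236067977499 \<le> sqrt 5" "sqrt 5 \<le> 2.2360679775"
    by (intro real_le_rsqrt real_le_lsqrt; simp add: power2_eq_square)+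
  define s :: real where "s = sqrt (5.323655\<^sup>2 - 1)"
  have s: "5.22889114048 \<le> s" "s \<le> 5.2288911405"
    unfolding s_def by (intro real_le_rsqrt real_le_lsqrt; simp add: power2_eq_square)+
  define c :: real where "c = (5.323655\<^sup>2 - 2 + sqrt 5 * s) / (2 * 5.323655\<^sup>2)"
  have "2.236067977499 * 5.22889114048 \<le> sqrt 5 * s"
    using sqrt5 s by (intro mult_mono) auto
  then have c: "0.6709899539 \<le> c"
    unfolding c_def by (simp add: power2_eq_square)
  have "0.6709899539\<^sup>2 \<le> c\<^sup>2" using c by (intro power_mono) auto
  then have r: "sqrt (1 - c\<^sup>2) \<le> 0.7414664402"
    by (intro real_le_lsqrt) (auto simp: power2_eq_square)
  have "s * (1 - 2 / 5.323655\<^sup>2) \<le> 5.2288911405 * (1 - 2 / 5.323655\<^sup>2)"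
    "sqrt 5 * (1 - 1 / 5.323655\<^sup>2) \<le> 2.2360679775 * (1 - 1 / 5.323655\<^sup>2)"
    using s sqrt5 by (intro mult_right_mono; simp add: power2_eq_square)+
  from add_mono[OF divide_right_mono[OF add_mono[OF this]] r, of 2]
  show "RB1_value 5.323655 \<le> 4.25"
    unfolding RB1_value_def s_def[symmetric] c_def[symmetric]
    by (rule order_trans) (simp_all add: power2_eq_square)
next
  have sqrt5: "2.2360679774 \<le> sqrt 5" "sqrt 5 \<le> 2.2360679775"
    by (intro real_le_rsqrt real_le_lsqrt; simp add: power2_eq_square)+
  define s :: real where "s = sqrt (5.323665\<^sup>2 - 1)"
  have s: "5.2289013217 \<le> s" "s \<le> 5.2289013218"
    unfolding s_def by (intro real_le_rsqrt real_le_lsqrt; simp add: power2_eq_square)+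
  define c :: real where "c = (5.323665\<^sup>2 - 2 + sqrt 5 * s) / (2 * 5.323665\<^sup>2)"
  have "0 \<le> sqrt 5 * s" "sqrt 5 * s \<le> 2.2360679775 * 5.2289013218"
    using sqrt5 s by (simp, intro mult_mono) auto
  then have c: "0 \<le> c" "c \<le> 0.67098972"
    unfolding c_def by (simp_all add: power2_eq_square)
  have "c\<^sup>2 \<le> 0.67098972\<^sup>2" using c by (intro power_mono) auto
  then have r: "0.74146665 \<le> sqrt (1 - c\<^sup>2)"
    by (intro real_le_rsqrt) (auto simp: power2_eq_square)
  have "5.2289013217 * (1 - 2 / 5.323665\<^sup>2) \<le> s * (1 - 2 / 5.323665\<^sup>2)"
    "2.2360679774 * (1 - 1 / 5.323665\<^sup>2) \<le> sqrt 5 * (1 - 1 / 5.323665\<^sup>2)"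
    using s sqrt5 by (intro mult_right_mono; simp add: power2_eq_square)+
  from add_mono[OF divide_right_mono[OF add_mono[OF this]] r, of 2]
  show "4.25 \<le> RB1_value 5.323665"
    unfolding RB1_value_def s_def[symmetric] c_def[symmetric]
    by (rule order_trans[rotated]) (simp_all add: power2_eq_square)
qed

section \<open>Optimality on either side of the threshold, and effectiveness\<close>

text \<open>Effectiveness quantifies over all instances of a radius; an actual instance is needed to
  read off a bound on the cost from it.\<close>

lemma SRD_exists:
  assumes "sqrt 2 < \<rho>"
  shows "\<exists>A B. SRD \<rho> A B"
proof -
  let ?\<alpha> = "arcsin (1 / \<rho>)"
  have \<rho>: "0 < \<rho>" using assms less_trans[of 0 "sqrt 2" \<rho>] by simp
  have "(norm (1 - cis (2 * ?\<alpha>)))\<^sup>2 = 2 - 2 * cos (2 * ?\<alpha>)"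
    unfolding cmod_power2 using sin_cos_squared_add[of "2 * ?\<alpha>"] by (simp add: power2_diff)
  also have "\<dots> = (2 / \<rho>)\<^sup>2"
    unfolding cos_double_sin arcsin_inverse_radius(1)[OF assms] by (simp add: power_divide)
  finally have n: "norm (1 - cis (2 * ?\<alpha>)) = 2 / \<rho>"
    using \<rho> by (simp add: power2_eq_iff_nonneg)
  have "SRD \<rho> (of_real \<rho>) (of_real \<rho> * cis (2 * ?\<alpha>))"
    using \<rho> n norm_mult[of "of_real \<rho>" "1 - cis (2 * ?\<alpha>)"]
    by (simp add: SRD_def dist_norm norm_mult right_diff_distrib)
  then show ?thesis by blast
qed

text \<open>Here the optimal \<open>\<gamma>\<close> is truncated to 0. For small radii
  \<open>\<beta>\<close> is 0 as well and the optimal pair is not unique, so uniqueness is expressed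
  for the resulting algorithm.\<close>

lemma optimal_below_threshold:
  assumes \<rho>: "sqrt 2 < \<rho>" "\<rho> < rho_threshold" and AB: "SRD \<rho> A B"
  defines "\<alpha> \<equiv> arcsin (1 / \<rho>)"
  defines "\<beta> \<equiv> max 0 (arccos (3/4) - \<alpha>)"
  shows "optimal_RB1 \<rho> A B (\<beta>, 0)"
    and "optimal_oneRB \<rho> A B b \<longleftrightarrow> b = \<beta>"
    and "RB 1 \<alpha> \<beta> 0 = oneRB \<alpha> \<beta>"
    and "optimal_RB1 \<rho> A B (b, g) \<Longrightarrow> RB 1 \<alpha> b g = oneRB \<alpha> \<beta>"
proof -
  note \<alpha> = arcsin_inverse_radius(2,3)[OF \<rho>(1), folded \<alpha>_def]
  have \<gamma>: "max 0 (arccos (2/3) - 2 * arcsin (1 / \<rho>)) = 0"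
    using rho_threshold_less_iff[OF \<rho>(1)] \<rho>(2) by (simp add: gamma_opt_def)
  note opt = optimal_iff[OF \<rho>(1) AB, unfolded \<gamma>, simplified, folded \<alpha>_def, folded \<beta>_def]
  show "optimal_RB1 \<rho> A B (\<beta>, 0)" "optimal_oneRB \<rho> A B b \<longleftrightarrow> b = \<beta>"
    using opt \<alpha> by auto
  have \<beta>: "0 \<le> \<beta>" "\<alpha> + \<beta> < pi"
    using arccos_le_pi2[of "3/4"] \<alpha> by (auto simp: \<beta>_def)
  show "RB 1 \<alpha> \<beta> 0 = oneRB \<alpha> \<beta>"
    using \<alpha> \<beta> by (intro RB1_eq_oneRB) auto
  assume "optimal_RB1 \<rho> A B (b, g)"
  then have "b = \<beta>" "\<beta> = 0 \<or> g = 0" using opt by auto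
  then show "RB 1 \<alpha> b g = oneRB \<alpha> \<beta>"
    using \<alpha> \<beta> RB1_eq_oneRB[of \<alpha> \<beta> g] by auto
qed

text \<open>Neither angle is truncated and \<open>beta_opt\<close> is positive, so the minimising
  pair is unique.\<close>

lemma optimal_above_threshold:
  assumes \<rho>: "sqrt 2 < \<rho>" "rho_threshold \<le> \<rho>" and AB: "SRD \<rho> A B"
  shows "optimal_RB1 \<rho> A B (b, g) \<longleftrightarrow> (b, g) = (beta_opt \<rho>, gamma_opt \<rho>)"
    and "expected_time (RB 1 (arcsin (1 / \<rho>)) (beta_opt \<rho>) (gamma_opt \<rho>)) A B = \<rho> * cos (beta_opt \<rho>)"
proof -
  define \<alpha> where "\<alpha> = arcsin (1 / \<rho>)"
  note \<alpha> = arcsin_inverse_radius[OF \<rho>(1), folded \<alpha>_def]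
  have \<rho>0: "0 < \<rho>" using \<rho> less_trans[of 0 "sqrt 2" \<rho>] by simp
  have g0: "0 \<le> gamma_opt \<rho>"
    using rho_threshold_less_iff[OF \<rho>(1)] \<rho>(2) by linarith
  then have \<gamma>: "max 0 (arccos (2/3) - 2 * arcsin (1 / \<rho>)) = gamma_opt \<rho>"
    by (simp add: gamma_opt_def)
  \<comment> \<open>From \<open>\<rho>\<^sup>2 \<ge> 6\<close> follows
    \<open>cos \<alpha> > 3/4 \<ge> 3/4 * cos (gamma_opt \<rho>)\<close>, which makes
    \<open>beta_opt\<close> positive.\<close>
  have "(sqrt 6)\<^sup>2 \<le> \<rho>\<^sup>2"
    using \<rho>(2) unfolding rho_threshold_eq by (intro power_mono) auto
  moreover have "(3/4 * \<rho>)\<^sup>2 = 9/16 * \<rho>\<^sup>2"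
    by (simp add: power2_eq_square)
  ultimately have "(3/4 * \<rho>)\<^sup>2 < \<rho>\<^sup>2 - 1"
    by simp
  then have "3/4 * \<rho> < sqrt (\<rho>\<^sup>2 - 1)"
    by (rule real_less_rsqrt)
  then have "3/4 < cos \<alpha>"
    unfolding \<alpha>(4) using \<rho>0 by (simp add: field_simps)
  then have "3/4 * cos (gamma_opt \<rho>) < cos \<alpha>" "-1 \<le> 3/4 * cos (gamma_opt \<rho>)"
    using cos_le_one[of "gamma_opt \<rho>"] cos_ge_minus_one[of "gamma_opt \<rho>"] by linarith+
  then have "arccos (cos \<alpha>) < arccos (3/4 * cos (gamma_opt \<rho>))"
    by (intro arccos_less_arccos) auto
  moreover have "arccos (cos \<alpha>) = \<alpha>"
    using \<alpha>(2,3) by (intro arccos_cos) auto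
  ultimately have b0: "0 < beta_opt \<rho>"
    unfolding beta_opt_def gamma_opt_def \<alpha>_def by linarith
  then have \<beta>: "max 0 (arccos (3/4 * cos (gamma_opt \<rho>)) - arcsin (1 / \<rho>)) = beta_opt \<rho>"
    by (simp add: beta_opt_def gamma_opt_def)
  have "gamma_opt \<rho> \<le> pi / 2 - \<alpha>"
    using arccos_le_pi2[of "2/3"] \<alpha> by (simp add: gamma_opt_def \<alpha>_def)
  then show "optimal_RB1 \<rho> A B (b, g) \<longleftrightarrow> (b, g) = (beta_opt \<rho>, gamma_opt \<rho>)"
    using optimal_iff(1)[OF \<rho>(1) AB, unfolded \<gamma> \<beta>] g0 b0 by (auto simp: \<alpha>_def)
  show "expected_time (RB 1 (arcsin (1 / \<rho>)) (beta_opt \<rho>) (gamma_opt \<rho>)) A B = \<rho> * cos (beta_opt \<rho>)"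
    using optimal_iff(2)[OF \<rho>(1) AB, unfolded \<gamma> \<beta>] .
qed

text \<open>The intermediate value theorem gives a radius in the bracket with cost exactly 4.25, and
  strict growth excludes every larger radius.\<close>

lemma effective_RB1:
  "\<exists>\<delta>. effective {\<rho>. sqrt 2 < \<rho> \<and> rho_threshold \<le> \<rho>}
      (\<lambda>\<rho>. RB 1 (arcsin (1/\<rho>)) (beta_opt \<rho>) (gamma_opt \<rho>)) \<delta> \<and>
    \<bar>\<delta> - 5.32366\<bar> \<le> 0.000005"
proof -
  have thr: "sqrt 2 < rho_threshold" "rho_threshold \<le> 5"
    by (auto simp: rho_threshold_eq intro!: real_le_lsqrt)
  have "continuous_on {5.323655..5.323665} RB1_value"
    unfolding RB1_value_def by (intro continuous_intros) auto
  then obtain \<delta> where \<delta>: "5.323655 \<le> \<delta>" "\<delta> \<le> 5.323665" "RB1_value \<delta> = 4.25"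
    using IVT'[of RB1_value "5.323655" "4.25" "5.323665"] RB1_value_bracket by auto
  have iff: "(\<forall>A B. SRD \<rho> A B \<longrightarrow>
      expected_time (RB 1 (arcsin (1/\<rho>)) (beta_opt \<rho>) (gamma_opt \<rho>)) A B \<le> 4.25)
      \<longleftrightarrow> RB1_value \<rho> \<le> 4.25" if "sqrt 2 < \<rho>" "rho_threshold \<le> \<rho>" for \<rho>
    using optimal_above_threshold(2)[OF that] rho_cos_beta_opt[OF that(1)] SRD_exists[OF that(1)] by auto
  have "effective {\<rho>. sqrt 2 < \<rho> \<and> rho_threshold \<le> \<rho>}
      (\<lambda>\<rho>. RB 1 (arcsin (1/\<rho>)) (beta_opt \<rho>) (gamma_opt \<rho>)) \<delta>"
    unfolding effective_def Let_def mem_Collect_eq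
  proof (intro conjI ballI)
    show "sqrt 2 < \<delta>" "rho_threshold \<le> \<delta>" using thr \<delta> by auto
    then show "\<forall>A B. SRD \<delta> A B \<longrightarrow>
        expected_time (RB 1 (arcsin (1/\<delta>)) (beta_opt \<delta>) (gamma_opt \<delta>)) A B \<le> 4.25"
      using iff \<delta> by simp
  next
    fix \<rho> assume "\<rho> \<in> {\<rho>. (sqrt 2 < \<rho> \<and> rho_threshold \<le> \<rho>) \<and> (\<forall>A B. SRD \<rho> A B \<longrightarrow>
      expected_time (RB 1 (arcsin (1/\<rho>)) (beta_opt \<rho>) (gamma_opt \<rho>)) A B \<le> 4.25)}"
    then have "RB1_value \<rho> \<le> 4.25" using iff[of \<rho>] by blast
    then show "\<rho> \<le> \<delta>"
      using RB1_value_strict_mono[of \<delta> \<rho>] thr \<delta> by (cases "\<rho> \<le> \<delta>") auto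
  qed
  moreover have "\<bar>\<delta> - 5.32366\<bar> \<le> 0.000005" using \<delta>(1,2) unfolding abs_le_iff by simp
  ultimately show ?thesis by blast
qed

theorem theorem4:
  shows
    "\<bar>rho_threshold - 2.44949\<bar> \<le> 0.000005 \<and>
     (\<forall>\<rho> A B. sqrt 2 < \<rho> \<and> \<rho> < rho_threshold \<and> SRD \<rho> A B \<longrightarrow>
        (let \<alpha> = arcsin (1/\<rho>); \<beta> = max 0 (arccos (3/4) - \<alpha>) in
           optimal_RB1 \<rho> A B (\<beta>, 0) \<and>
           (\<forall>b. optimal_oneRB \<rho> A B b \<longleftrightarrow> b = \<beta>) \<and>
           RB 1 \<alpha> \<beta> 0 = oneRB \<alpha> \<beta> \<and>
           (\<forall>b g. optimal_RB1 \<rho> A B (b, g) \<longrightarrow> RB 1 \<alpha> b g = oneRB \<alpha> \<beta>))) \<and>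
     (\<forall>\<rho> A B. sqrt 2 < \<rho> \<and> rho_threshold \<le> \<rho> \<and> SRD \<rho> A B \<longrightarrow>
        (\<forall>b g. optimal_RB1 \<rho> A B (b, g) \<longleftrightarrow> (b, g) = (beta_opt \<rho>, gamma_opt \<rho>)) \<and>
        competitive_ratio (RB 1 (arcsin (1/\<rho>)) (beta_opt \<rho>) (gamma_opt \<rho>)) A B
          = \<rho> * cos (beta_opt \<rho>) \<and>
        \<rho> * cos (beta_opt \<rho>)
          = 1/2 * (- (sqrt 5 / \<rho>^2) + sqrt (\<rho>^2 - 1) - 2 * sqrt (\<rho>^2 - 1) / \<rho>^2
                   + 2 * sqrt (1 - (\<rho> * (sqrt (5 - 5/\<rho>^2) + \<rho>) - 2)^2 / (4 * \<rho>^4)) + sqrt 5)) \<and>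
     (\<exists>\<delta>. effective {\<rho>. sqrt 2 < \<rho> \<and> rho_threshold \<le> \<rho>}
             (\<lambda>\<rho>. RB 1 (arcsin (1/\<rho>)) (beta_opt \<rho>) (gamma_opt \<rho>)) \<delta> \<and>
          \<bar>\<delta> - 5.32366\<bar> \<le> 0.000005)"
proof (intro conjI allI impI effective_RB1; (elim conjE)?)
  have "2.449485 \<le> sqrt 6" "sqrt 6 \<le> 2.449495"
    by (intro real_le_rsqrt real_le_lsqrt; simp add: power2_eq_square)+
  then show "\<bar>rho_threshold - 2.44949\<bar> \<le> 0.000005"
    unfolding rho_threshold_eq abs_le_iff by simp
next
  fix \<rho> A B assume "sqrt 2 < \<rho>" "\<rho> < rho_threshold" "SRD \<rho> A B"
  from optimal_below_threshold[OF this]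
  show "let \<alpha> = arcsin (1/\<rho>); \<beta> = max 0 (arccos (3/4) - \<alpha>) in
           optimal_RB1 \<rho> A B (\<beta>, 0) \<and>
           (\<forall>b. optimal_oneRB \<rho> A B b \<longleftrightarrow> b = \<beta>) \<and>
           RB 1 \<alpha> \<beta> 0 = oneRB \<alpha> \<beta> \<and>
           (\<forall>b g. optimal_RB1 \<rho> A B (b, g) \<longrightarrow> RB 1 \<alpha> b g = oneRB \<alpha> \<beta>)"
    unfolding Let_def by blast
next
  fix \<rho> A B b g assume \<rho>: "sqrt 2 < \<rho>" "rho_threshold \<le> \<rho>" and AB: "SRD \<rho> A B"
  show "optimal_RB1 \<rho> A B (b, g) \<longleftrightarrow> (b, g) = (beta_opt \<rho>, gamma_opt \<rho>)"
    using \<rho> AB by (rule optimal_above_threshold)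
next
  fix \<rho> A B assume \<rho>: "sqrt 2 < \<rho>" "rho_threshold \<le> \<rho>" and AB: "SRD \<rho> A B"
  then show "competitive_ratio (RB 1 (arcsin (1/\<rho>)) (beta_opt \<rho>) (gamma_opt \<rho>)) A B
      = \<rho> * cos (beta_opt \<rho>)"
    \<comment> \<open>The robots start at distance 2, so the offline optimum is 1 and the ratio is
      the expected time.\<close>
    unfolding competitive_ratio_def using optimal_above_threshold(2)[OF \<rho> AB] by (simp add: SRD_def)
  have "1 < \<rho>" using \<rho>(1) less_trans[of 1 "sqrt 2" \<rho>] by simp
  then show "\<rho> * cos (beta_opt \<rho>)
      = 1/2 * (- (sqrt 5 / \<rho>^2) + sqrt (\<rho>^2 - 1) - 2 * sqrt (\<rho>^2 - 1) / \<rho>^2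
               + 2 * sqrt (1 - (\<rho> * (sqrt (5 - 5/\<rho>^2) + \<rho>) - 2)^2 / (4 * \<rho>^4)) + sqrt 5)"
    using rho_cos_beta_opt[OF \<rho>(1)] RB1_value_eq by simp
qed

end
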